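(* Let $N>2$, let $\alpha_\mu<0$ for $0<\mu<N$, and let $\alpha_0=\min_{0<\mu<N}|\alpha_\mu|$. Then the lowest energy configuration of the spin polygon with couplings $\alpha_0,\alpha_1,\dots,\alpha_{N-1}$ is not collinear, and hence is coplanar.
   Context: Spin polygon: unit vectors $\mathbf{s}_0,\dots,\mathbf{s}_{N-1}\in\mathbb{R}^3$ (indices modulo $N$) with energy $E=\sum_{\mu=0}^{N-1}\alpha_\mu\,\mathbf{s}_\mu\cdot\mathbf{s}_{\mu+1}$. A lowest energy configuration (LEC) is a global minimizer of $E$. A configuration is collinear (coplanar) if its vectors span a one-dimensional (two-dimensional) subspace of $\mathbb{R}^3$; every LEC is one or the other. *)

theory Defs
  imports "HOL-Analysis.Analysis"
begin

text \<open>A spin polygon with \<open>N\<close> vertices is given by its couplings \<open>\<alpha> \<mu>\<close>, \<open>\<mu> < N\<close>, and a spin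
  configuration by vectors \<open>s \<mu>\<close>, \<open>\<mu> < N\<close>; values of \<open>\<alpha>\<close> and \<open>s\<close> at indices \<open>\<ge> N\<close> are ignored.\<close>

definition spin_config :: "nat \<Rightarrow> (nat \<Rightarrow> real ^ 3) \<Rightarrow> bool" where
  "spin_config N s \<longleftrightarrow> (\<forall>\<mu><N. norm (s \<mu>) = 1)"

definition energy :: "nat \<Rightarrow> (nat \<Rightarrow> real) \<Rightarrow> (nat \<Rightarrow> real ^ 3) \<Rightarrow> real" where
  "energy N \<alpha> s = (\<Sum>\<mu><N. \<alpha> \<mu> * (s \<mu> \<bullet> s ((\<mu> + 1) mod N)))"

definition lowest_energy_config :: "nat \<Rightarrow> (nat \<Rightarrow> real) \<Rightarrow> (nat \<Rightarrow> real ^ 3) \<Rightarrow> bool" where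
  "lowest_energy_config N \<alpha> s \<longleftrightarrow>
     spin_config N s \<and> (\<forall>t. spin_config N t \<longrightarrow> energy N \<alpha> s \<le> energy N \<alpha> t)"

text \<open>Collinearity and coplanarity refer to the linear span, so they differ from the affine notions
  \<open>collinear\<close> and \<open>coplanar\<close> of the library; also, a collinear configuration is not coplanar.\<close>

definition collinear_config :: "nat \<Rightarrow> (nat \<Rightarrow> real ^ 3) \<Rightarrow> bool" where
  "collinear_config N s \<longleftrightarrow> dim (span (s ` {..<N})) = 1"

definition coplanar_config :: "nat \<Rightarrow> (nat \<Rightarrow> real ^ 3) \<Rightarrow> bool" where
  "coplanar_config N s \<longleftrightarrow> dim (span (s ` {..<N})) = 2"

end

theory Submission imports Defs begin

text \<open>Minimality with respect to a single spin puts it antiparallel to its local field, so each spin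
  is a linear combination of the two preceding ones: a lowest energy configuration has dimension at
  most 2. A collinear configuration has an odd number of frustrated bonds, each of which costs at
  least \<open>2 * \<alpha> 0\<close>, hence energy at least \<open>\<Sum>\<mu><N. \<alpha> \<mu>\<close>. A planar configuration that
  turns only at bond \<open>0\<close>, at a bond of minimal strength \<open>a\<close> and at one further bond of strength \<open>b\<close>
  goes below this bound: take a right angle at the minimal bond and an angle \<open>y\<close> with
  \<open>tan (y/2) = a/(2b)\<close> at the other.\<close>

section \<open>Local minimality and the span of a lowest energy configuration\<close>

lemma unit_vectors_inner_eq_1:
  fixes x y :: "'a::real_inner"
  assumes "norm x = 1" "norm y = 1" "x \<bullet> y = 1"
  shows "x = y"
proof -
  have "(x - y) \<bullet> (x - y) = 0"
    using assms by (simp add: norm_eq_1 inner_diff inner_commute)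
  then show ?thesis by simp
qed

text \<open>Comparison with the unit vector opposite to \<open>h\<close> gives
  \<open>x \<bullet> h \<le> - norm h\<close>, which is the equality case of Cauchy-Schwarz.\<close>

lemma antiparallel_if_minimal_inner:
  fixes x h :: "'a::real_inner"
  assumes "norm x = 1" and min: "\<And>u. norm u = 1 \<Longrightarrow> x \<bullet> h \<le> u \<bullet> h"
  shows "h = - norm h *\<^sub>R x"
proof (cases "h = 0")
  case False
  have "x \<bullet> h \<le> - (h /\<^sub>R norm h) \<bullet> h"
    by (rule min) (use False in simp)
  also have "\<dots> = - norm h"
    using False by (simp add: dot_square_norm power2_eq_square)
  finally have le: "x \<bullet> h \<le> - norm h" .
  have "x \<bullet> x = 1" "h \<bullet> h = norm h * norm h"
    using assms(1) by (simp_all add: norm_eq_1 dot_square_norm power2_eq_square)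
  then have "(h + norm h *\<^sub>R x) \<bullet> (h + norm h *\<^sub>R x) = 2 * norm h * (norm h + x \<bullet> h)"
    by (simp add: inner_add inner_commute algebra_simps)
  also have "\<dots> \<le> 0"
    using le by (intro mult_nonneg_nonpos) auto
  finally have "h + norm h *\<^sub>R x = 0"
    by (metis inner_ge_zero inner_eq_zero_iff order_antisym)
  then show ?thesis by (simp add: eq_neg_iff_add_eq_0)
qed simp

text \<open>Only the two bonds at the changed spin are affected, and each is linear in it; the
  second factor is the local field.\<close>

lemma energy_fun_upd_interior:
  assumes "Suc (Suc \<mu>) < N"
  shows "energy N \<alpha> (s(Suc \<mu> := u)) - energy N \<alpha> s =
    (u - s (Suc \<mu>)) \<bullet> (\<alpha> \<mu> *\<^sub>R s \<mu> + \<alpha> (Suc \<mu>) *\<^sub>R s (Suc (Suc \<mu>)))"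
proof -
  let ?t = "s(Suc \<mu> := u)"
  let ?d = "\<lambda>\<nu>. \<alpha> \<nu> * (?t \<nu> \<bullet> ?t ((\<nu> + 1) mod N)) - \<alpha> \<nu> * (s \<nu> \<bullet> s ((\<nu> + 1) mod N))"
  have "energy N \<alpha> ?t - energy N \<alpha> s = (\<Sum>\<nu><N. ?d \<nu>)"
    by (simp add: energy_def sum_subtractf)
  also have "\<dots> = (\<Sum>\<nu>\<in>{\<mu>, Suc \<mu>}. ?d \<nu>)"
  proof (rule sum.mono_neutral_right)
    show "\<forall>\<nu>\<in>{..<N} - {\<mu>, Suc \<mu>}. ?d \<nu> = 0"
    proof
      fix \<nu> assume \<nu>: "\<nu> \<in> {..<N} - {\<mu>, Suc \<mu>}"
      then have "(\<nu> + 1) mod N \<noteq> Suc \<mu>"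
        using assms by (cases "Suc \<nu> = N") auto
      then show "?d \<nu> = 0" using \<nu> by simp
    qed
  qed (use assms in auto)
  also have "\<dots> = (u - s (Suc \<mu>)) \<bullet> (\<alpha> \<mu> *\<^sub>R s \<mu> + \<alpha> (Suc \<mu>) *\<^sub>R s (Suc (Suc \<mu>)))"
    using assms by (simp add: inner_diff_left inner_diff_right inner_add_right inner_commute algebra_simps)
  finally show ?thesis .
qed

text \<open>The local field at \<open>Suc \<nu>\<close> is a multiple of
  \<open>s (Suc \<nu>)\<close>, so it can be solved for the next spin. The divisor
  \<open>\<alpha> (Suc \<nu>)\<close> has positive index, hence is nonzero.\<close>

lemma lowest_energy_in_span:
  assumes lec: "lowest_energy_config N \<alpha> s" and "\<And>\<mu>. 0 < \<mu> \<Longrightarrow> \<mu> < N \<Longrightarrow> \<alpha> \<mu> \<noteq> 0"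
    and "\<mu> < N"
  shows "s \<mu> \<in> span {s 0, s 1}"
  using \<open>\<mu> < N\<close>
proof (induction \<mu> rule: less_induct)
  case (less \<mu>)
  consider "\<mu> = 0" | "\<mu> = 1" | \<nu> where "\<mu> = Suc (Suc \<nu>)"
    by (metis One_nat_def not0_implies_Suc)
  then show ?case
  proof cases
    case 3
    define h where "h = \<alpha> \<nu> *\<^sub>R s \<nu> + \<alpha> (Suc \<nu>) *\<^sub>R s \<mu>"
    have sc: "spin_config N s" and
      min: "\<And>t. spin_config N t \<Longrightarrow> energy N \<alpha> s \<le> energy N \<alpha> t"
      using lec by (auto simp: lowest_energy_config_def)
    have "s (Suc \<nu>) \<bullet> h \<le> u \<bullet> h" if "norm u = 1" for u
    proof -
      have "spin_config N (s(Suc \<nu> := u))"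
        using sc that by (simp add: spin_config_def)
      from min[OF this] show ?thesis
        using energy_fun_upd_interior[of \<nu> N \<alpha> s u] less.prems 3
        by (simp add: h_def inner_diff_left)
    qed
    then have "h = - norm h *\<^sub>R s (Suc \<nu>)"
      using sc less.prems 3 by (intro antiparallel_if_minimal_inner) (auto simp: spin_config_def)
    moreover have "s \<nu> \<in> span {s 0, s 1}" "s (Suc \<nu>) \<in> span {s 0, s 1}"
      using less 3 by auto
    ultimately have "h - \<alpha> \<nu> *\<^sub>R s \<nu> \<in> span {s 0, s 1}"
      by (metis span_diff span_scale)
    then have "\<alpha> (Suc \<nu>) *\<^sub>R s \<mu> \<in> span {s 0, s 1}"
      by (simp add: h_def)
    then have "inverse (\<alpha> (Suc \<nu>)) *\<^sub>R \<alpha> (Suc \<nu>) *\<^sub>R s \<mu> \<in> span {s 0, s 1}"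
      by (rule span_scale)
    then show ?thesis
      using assms(2)[of "Suc \<nu>"] less.prems 3 by simp
  qed (auto intro: span_base)
qed

section \<open>Energy bound for collinear configurations\<close>

lemma dim_1_unit_inner:
  fixes x y :: "'a::euclidean_space"
  assumes "dim S = 1" "x \<in> S" "y \<in> S" "norm x = 1" "norm y = 1"
  shows "x \<bullet> y = 1 \<or> x \<bullet> y = - 1"
proof -
  have "dim {x} = 1"
    using assms(4) by (subst dim_eq_card_independent) auto
  then have "span {x} = span S"
    using assms by (intro dim_eq_span) auto
  then have "y \<in> span {x}"
    using assms(3) by (simp add: span_base)
  then obtain c where "y = c *\<^sub>R x"
    by (auto simp: span_singleton)
  then show ?thesis
    using assms by (auto simp: dot_square_norm abs_if split: if_splits)
qed

text \<open>Energies are measured against the value for a constant spin configuration, so that every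
  aligned bond contributes zero.\<close>

lemma energy_minus_sum:
  "energy N \<alpha> s - (\<Sum>\<mu><N. \<alpha> \<mu>) = (\<Sum>\<mu><N. \<alpha> \<mu> * (s \<mu> \<bullet> s ((\<mu> + 1) mod N) - 1))"
  by (simp add: energy_def sum_subtractf right_diff_distrib)

lemma collinear_energy_ge:
  assumes "N > 2" and neg: "\<And>\<mu>. 0 < \<mu> \<Longrightarrow> \<mu> < N \<Longrightarrow> \<alpha> \<mu> < 0"
    and small: "\<And>\<mu>. 0 < \<mu> \<Longrightarrow> \<mu> < N \<Longrightarrow> \<alpha> 0 \<le> - \<alpha> \<mu>"
    and sc: "spin_config N s" and "collinear_config N s"
  shows "(\<Sum>\<mu><N. \<alpha> \<mu>) \<le> energy N \<alpha> s"
proof -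
  define \<beta> where "\<beta> \<mu> = s \<mu> \<bullet> s ((\<mu> + 1) mod N)" for \<mu>
  have unit: "norm (s \<mu>) = 1" if "\<mu> < N" for \<mu>
    using sc that by (simp add: spin_config_def)
  have "dim (s ` {..<N}) = 1"
    using assms(5) by (simp add: collinear_config_def)
  then have \<beta>: "\<beta> \<mu> = 1 \<or> \<beta> \<mu> = - 1" if "\<mu> < N" for \<mu>
    unfolding \<beta>_def by (rule dim_1_unit_inner) (use that unit in auto)
  have nonneg: "0 \<le> \<alpha> \<mu> * (\<beta> \<mu> - 1)" if "0 < \<mu>" "\<mu> < N" for \<mu>
    using neg[OF that] \<beta>[OF that(2)] by auto
  have "0 \<le> (\<Sum>\<mu><N. \<alpha> \<mu> * (\<beta> \<mu> - 1))"
  \<comment> \<open>Only bond \<open>0\<close> can contribute negatively, and only when it is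
    flipped.\<close>
  proof (cases "\<beta> 0 = 1")
    case True
    show ?thesis
    proof (rule sum_nonneg)
      fix \<mu> assume "\<mu> \<in> {..<N}"
      then show "0 \<le> \<alpha> \<mu> * (\<beta> \<mu> - 1)"
        using True nonneg by (cases "\<mu> = 0") auto
    qed
  next
    case False
    \<comment> \<open>Flips come in pairs around a closed polygon: if all other bonds were aligned,
      following them from \<open>s 1\<close> back to \<open>s 0\<close> would align bond
      \<open>0\<close> too.\<close>
    have "\<exists>k. 0 < k \<and> k < N \<and> \<beta> k \<noteq> 1"
    proof (rule ccontr)
      assume "\<not> ?thesis"
      then have one: "s k \<bullet> s (Suc k mod N) = 1" if "0 < k" "k < N" for k
        using that by (auto simp: \<beta>_def)
      have step: "s k = s (Suc k mod N)" if "0 < k" "k < N" for k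
        by (rule unit_vectors_inner_eq_1[OF unit unit one]) (use that in simp_all)
      have "s (Suc k mod N) = s 1" if "k < N" for k
        using that
      proof (induction k)
        case 0
        then show ?case using \<open>N > 2\<close> by simp
      next
        case (Suc k)
        then show ?case using step[of "Suc k"] by simp
      qed
      from this[of "N - 1"] have "s 0 = s 1"
        using \<open>N > 2\<close> by simp
      then have "\<beta> 0 = 1"
        using \<open>N > 2\<close> unit[of 1] by (simp add: \<beta>_def dot_square_norm)
      with False show False ..
    qed
    then obtain k where k: "0 < k" "k < N" "\<beta> k \<noteq> 1" by blast
    \<comment> \<open>Both bonds are flipped, so the sum is
      \<open>- 2 * \<alpha> 0 - 2 * \<alpha> k\<close>.\<close>
    have "0 \<le> (\<Sum>\<mu>\<in>{0, k}. \<alpha> \<mu> * (\<beta> \<mu> - 1))"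
      using \<beta>[of 0] \<beta>[of k] False k small[of k] by auto
    also have "\<dots> \<le> (\<Sum>\<mu><N. \<alpha> \<mu> * (\<beta> \<mu> - 1))"
      using k nonneg by (intro sum_mono2) auto
    finally show ?thesis .
  qed
  then show ?thesis
    using energy_minus_sum[of N \<alpha> s] by (simp add: \<beta>_def)
qed

section \<open>Planar configurations below the collinear bound\<close>

lemma energy_three_blocks:
  fixes p q r :: "real ^ 3"
  assumes "0 < i" "i < j" "j < N" "norm p = 1" "norm q = 1" "norm r = 1"
  shows "\<exists>t. spin_config N t \<and> energy N \<alpha> t - (\<Sum>\<mu><N. \<alpha> \<mu>) =
    \<alpha> 0 * (r \<bullet> p - 1) + \<alpha> i * (p \<bullet> q - 1) + \<alpha> j * (q \<bullet> r - 1)"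
proof -
  \<comment> \<open>The block of \<open>r\<close> wraps around through index \<open>0\<close>; it is
    just that index if \<open>j = N - 1\<close>. Turns occur only at bonds \<open>0\<close>,
    \<open>i\<close> and \<open>j\<close>.\<close>
  define t where "t \<mu> = (if 0 < \<mu> \<and> \<mu> \<le> i then p else if i < \<mu> \<and> \<mu> \<le> j then q else r)" for \<mu>
  let ?d = "\<lambda>\<mu>. \<alpha> \<mu> * (t \<mu> \<bullet> t ((\<mu> + 1) mod N) - 1)"
  have "spin_config N t"
    using assms by (simp add: spin_config_def t_def)
  have sq: "p \<bullet> p = 1" "q \<bullet> q = 1" "r \<bullet> r = 1"
    using assms by (auto simp: dot_square_norm)
  have "(\<Sum>\<mu><N. ?d \<mu>) = (\<Sum>\<mu>\<in>{0, i, j}. ?d \<mu>)"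
  proof (rule sum.mono_neutral_right)
    show "\<forall>\<mu>\<in>{..<N} - {0, i, j}. ?d \<mu> = 0"
    proof
      fix \<mu> assume \<mu>: "\<mu> \<in> {..<N} - {0, i, j}"
      then have "t ((\<mu> + 1) mod N) = t \<mu>"
        using assms by (cases "Suc \<mu> = N") (auto simp: t_def)
      moreover have "t \<mu> \<bullet> t \<mu> = 1"
        using sq by (simp add: t_def)
      ultimately show "?d \<mu> = 0" by simp
    qed
  qed (use assms in auto)
  also have "\<dots> = \<alpha> 0 * (r \<bullet> p - 1) + \<alpha> i * (p \<bullet> q - 1) + \<alpha> j * (q \<bullet> r - 1)"
  proof -
    have "t ((j + 1) mod N) = r"
      using assms by (cases "Suc j = N") (auto simp: t_def)
    moreover have "t 0 = r" "t (1 mod N) = p" "t i = p" "t ((i + 1) mod N) = q" "t j = q"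
      using assms by (auto simp: t_def)
    ultimately show ?thesis using assms by simp
  qed
  finally show ?thesis
    using \<open>spin_config N t\<close> energy_minus_sum[of N \<alpha> t] by auto
qed

text \<open>The expression is the excess energy for couplings \<open>a\<close>, \<open>-a\<close>,
  \<open>-b\<close>, whose constants cancel in the first two bonds. Turning \<open>r\<close> from
  \<open>q\<close> away from \<open>p\<close> by a small angle gains to first order in
  \<open>a\<close> and costs only to second order in \<open>b\<close>.\<close>

lemma frustrated_triangle:
  fixes a b :: real
  assumes "a > 0" "b > 0"
  obtains p q r :: "real ^ 3" where "norm p = 1" "norm q = 1" "norm r = 1"
    "a * (r \<bullet> p - p \<bullet> q) + b * (1 - q \<bullet> r) < 0"
proof
  define T where "T = a / (2 * b)"
  define p :: "real ^ 3" where "p = axis 1 1"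
  define q :: "real ^ 3" where "q = axis 2 1"
  \<comment> \<open>Half-angle formulas: with \<open>T = tan (y/2)\<close>, \<open>S\<close> is
    \<open>sin y\<close> and \<open>C\<close> is \<open>cos y\<close>.\<close>
  define S where "S = 2 * T / (1 + T\<^sup>2)"
  define C where "C = (1 - T\<^sup>2) / (1 + T\<^sup>2)"
  define r where "r = C *\<^sub>R q - S *\<^sub>R p"
  have pq: "p \<bullet> p = 1" "q \<bullet> q = 1" "p \<bullet> q = 0" "q \<bullet> p = 0"
    by (auto simp: p_def q_def inner_axis_axis)
  have "T > 0" "b * T = a / 2" using assms by (auto simp: T_def)
  have pos: "1 + T\<^sup>2 > 0" by (simp add: add_pos_nonneg)
  show "norm p = 1" "norm q = 1"
    using pq by (auto simp: norm_eq_1)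
  have "C\<^sup>2 + S\<^sup>2 = ((1 - T\<^sup>2)\<^sup>2 + (2 * T)\<^sup>2) / (1 + T\<^sup>2)\<^sup>2"
    by (simp add: C_def S_def power_divide add_divide_distrib)
  also have "(1 - T\<^sup>2)\<^sup>2 + (2 * T)\<^sup>2 = (1 + T\<^sup>2)\<^sup>2"
    by (simp add: power2_eq_square algebra_simps)
  finally have "C\<^sup>2 + S\<^sup>2 = 1" using pos by simp
  then show "norm r = 1"
    by (simp add: norm_eq_1 r_def inner_diff pq power2_eq_square)
  \<comment> \<open>This turns the excess into \<open>S * (b * T - a)\<close>, and the choice of
    \<open>T\<close> makes the bracket \<open>- a / 2\<close>.\<close>
  have "1 - C = S * T"
    using pos by (simp add: C_def S_def field_simps power2_eq_square)
  then have "a * (r \<bullet> p - p \<bullet> q) + b * (1 - q \<bullet> r) = - (a * S) + S * (b * T)"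
    by (simp add: r_def inner_diff pq)
  also have "\<dots> = - (a * S) / 2"
    unfolding \<open>b * T = a / 2\<close> by simp
  also have "\<dots> < 0"
    using assms \<open>T > 0\<close> pos by (simp add: S_def)
  finally show "a * (r \<bullet> p - p \<bullet> q) + b * (1 - q \<bullet> r) < 0" .
qed

lemma exists_energy_less_sum:
  assumes "N > 2" and neg: "\<And>\<mu>. 0 < \<mu> \<Longrightarrow> \<mu> < N \<Longrightarrow> \<alpha> \<mu> < 0"
    and m: "0 < m" "m < N" "\<alpha> 0 = - \<alpha> m"
  shows "\<exists>t. spin_config N t \<and> energy N \<alpha> t < (\<Sum>\<mu><N. \<alpha> \<mu>)"
proof -
  \<comment> \<open>Any bond other than \<open>0\<close> and \<open>m\<close> serves as the third
    one; \<open>N > 2\<close> provides it.\<close>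
  define k :: nat where "k = (if m = 1 then 2 else 1)"
  have k: "0 < k" "k < N" "k \<noteq> m"
    using \<open>N > 2\<close> by (auto simp: k_def)
  obtain p q r :: "real ^ 3" where pqr: "norm p = 1" "norm q = 1" "norm r = 1"
    and lt: "\<alpha> 0 * (r \<bullet> p - p \<bullet> q) + (- \<alpha> k) * (1 - q \<bullet> r) < 0"
    by (rule frustrated_triangle[of "\<alpha> 0" "- \<alpha> k"])
      (use neg[OF m(1,2)] neg[OF k(1,2)] m(3) in simp_all)
  have lt': "\<alpha> 0 * (r \<bullet> p - 1) + \<alpha> m * (p \<bullet> q - 1) + \<alpha> k * (q \<bullet> r - 1) < 0"
    using lt m(3) by (simp add: algebra_simps)
  show ?thesis
  proof (cases "m < k")
    case True
    obtain t where "spin_config N t" "energy N \<alpha> t - (\<Sum>\<mu><N. \<alpha> \<mu>) =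
      \<alpha> 0 * (r \<bullet> p - 1) + \<alpha> m * (p \<bullet> q - 1) + \<alpha> k * (q \<bullet> r - 1)"
      using energy_three_blocks[OF m(1) True k(2) pqr] by blast
    with lt' show ?thesis by (intro exI[of _ t]) simp
  next
    case False
    then have "k < m" using k by simp
    \<comment> \<open>Here bond \<open>k\<close> comes first; traversing the triangle backwards
      keeps each coupling with its own pair of vectors.\<close>
    obtain t where "spin_config N t" "energy N \<alpha> t - (\<Sum>\<mu><N. \<alpha> \<mu>) =
      \<alpha> 0 * (p \<bullet> r - 1) + \<alpha> k * (r \<bullet> q - 1) + \<alpha> m * (q \<bullet> p - 1)"
      using energy_three_blocks[OF k(1) \<open>k < m\<close> m(2) pqr(3,2,1)] by blast
    with lt' show ?thesis by (intro exI[of _ t]) (simp add: inner_commute)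
  qed
qed

theorem mainTheorem12:
  fixes N :: nat and \<alpha> :: "nat \<Rightarrow> real" and s :: "nat \<Rightarrow> real ^ 3"
  assumes "N > 2"
    and "\<And>\<mu>. 0 < \<mu> \<Longrightarrow> \<mu> < N \<Longrightarrow> \<alpha> \<mu> < 0"
    and "\<alpha> 0 = Min ((\<lambda>\<mu>. \<bar>\<alpha> \<mu>\<bar>) ` {0<..<N})"
    and "lowest_energy_config N \<alpha> s"
  shows "\<not> collinear_config N s \<and> coplanar_config N s"
proof -
  let ?A = "(\<lambda>\<mu>. \<bar>\<alpha> \<mu>\<bar>) ` {0<..<N}"
  have sc: "spin_config N s" and min: "\<And>t. spin_config N t \<Longrightarrow> energy N \<alpha> s \<le> energy N \<alpha> t"
    using assms(4) by (auto simp: lowest_energy_config_def)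
  \<comment> \<open>The index set is nonempty, so the minimum is attained at some bond
    \<open>m\<close>.\<close>
  have "1 \<in> {0<..<N}" using assms(1) by simp
  then have "\<alpha> 0 \<in> ?A"
    unfolding assms(3) by (intro Min_in) blast+
  then obtain m where m: "0 < m" "m < N" "\<alpha> 0 = \<bar>\<alpha> m\<bar>" by auto
  then have "\<alpha> 0 = - \<alpha> m" using assms(2)[of m] by simp
  then obtain t where t: "spin_config N t" "energy N \<alpha> t < (\<Sum>\<mu><N. \<alpha> \<mu>)"
    using exists_energy_less_sum[of N \<alpha> m] assms(1,2) m by blast
  have small: "\<alpha> 0 \<le> - \<alpha> \<mu>" if "0 < \<mu>" "\<mu> < N" for \<mu>
  proof -
    have "\<alpha> 0 \<le> \<bar>\<alpha> \<mu>\<bar>"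
      unfolding assms(3) using that by (intro Min_le) auto
    then show ?thesis using assms(2)[OF that] by simp
  qed
  have nc: "\<not> collinear_config N s"
  proof
    assume "collinear_config N s"
    then have "(\<Sum>\<mu><N. \<alpha> \<mu>) \<le> energy N \<alpha> s"
      using assms(1,2) small sc by (intro collinear_energy_ge)
    then show False using min[OF t(1)] t(2) by linarith
  qed
  have "\<alpha> \<mu> \<noteq> 0" if "0 < \<mu>" "\<mu> < N" for \<mu>
    using assms(2)[OF that] by simp
  then have "s ` {..<N} \<subseteq> span {s 0, s 1}"
    using lowest_energy_in_span[OF assms(4)] by blast
  then have "dim (s ` {..<N}) \<le> card {s 0, s 1}"
    by (rule dim_le_card) simp
  also have "\<dots> \<le> 2" by (simp add: card_insert_if)
  finally have "dim (s ` {..<N}) \<le> 2" .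
  \<comment> \<open>Unit vectors exclude dimension 0 and non-collinearity excludes 1, which leaves
    2.\<close>
  moreover have "dim (s ` {..<N}) \<noteq> 0"
  proof
    assume "dim (s ` {..<N}) = 0"
    then have "s 0 = 0" using assms(1) by (simp add: dim_eq_0 image_subset_iff)
    then show False using sc assms(1) by (auto simp: spin_config_def)
  qed
  ultimately show ?thesis
    using nc unfolding collinear_config_def coplanar_config_def dim_span by linarith
qed

end
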